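(* Let $\mathcal{H}=\mathbb{R}^n$, let $t\in\mathbb{N}\smallsetminus\{0\}$, and let $F_1,\ldots,F_t$ be linear isometries on $\mathcal{H}$. Let $\Omega(F_1,\ldots,F_t)$ be the set of all finite compositions of operators from $\{F_1,\ldots,F_t\}$ (including the empty composition $\mathrm{Id}$), and let $\widetilde{\mathcal{S}}$ be a finite subset of $\Omega(F_1,\ldots,F_t)$ such that $\{\mathrm{Id},F_1,F_2,\ldots,F_t\}\subseteq\widetilde{\mathcal{S}}$. Let $\omega_1,\ldots,\omega_t$ be real numbers in $]0,1]$ with $\sum_{i=1}^t\omega_i=1$ and let $\alpha_1,\ldots,\alpha_t$ be real numbers in $]0,1[$. Set $A:=\sum_{i=1}^t\omega_iA_i$, where $A_i:=(1-\alpha_i)\mathrm{Id}+\alpha_iF_i$ for every $i\in\{1,\ldots,t\}$. Then: (i) $\operatorname{Fix} CC_{\widetilde{\mathcal{S}}}=\bigcap_{T\in\widetilde{\mathcal{S}}}\operatorname{Fix}T=\bigcap_{i=1}^t\operatorname{Fix}F_i=\operatorname{Fix}A$. (ii) $\|A\,\mathrm{P}_{(\cap_{i=1}^t\operatorname{Fix}F_i)^\perp}\|<1$, and for every $x\in\mathcal{H}$ and every $k\in\mathbb{N}$, $$\|CC_{\widetilde{\mathcal{S}}}^k x-\mathrm{P}_{\cap_{i=1}^t\operatorname{Fix}F_i}x\|\le\|A\,\mathrm{P}_{(\cap_{i=1}^t\operatorname{Fix}F_i)^\perp}\|^k\,\|x-\mathrm{P}_{\cap_{i=1}^t\operatorname{Fix}F_i}x\|.$$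 Consequently, $(CC_{\widetilde{\mathcal{S}}}^kx)_{k\in\mathbb{N}}$ converges to $\mathrm{P}_{\cap_{i=1}^t\operatorname{Fix}F_i}x$ with linear rate $\|A\,\mathrm{P}_{(\cap_{i=1}^t\operatorname{Fix}F_i)^\perp}\|$.
   Context: $\mathbb{N}=\{0,1,2,\ldots\}$, and $\gamma^0=1$ also for $\gamma=0$. A map $T:\mathcal{H}\to\mathcal{H}$ is an isometry if $\|Tx-Ty\|=\|x-y\|$ for all $x,y\in\mathcal{H}$. $\operatorname{Fix}T=\{x: Tx=x\}$. $\mathrm{P}_C$ is the projector (best approximation operator) onto $C$; $C^\perp$ is the orthogonal complement; $\|\cdot\|$ of a linear operator is the operator norm. Circumcenter mapping: for a finite set $\mathcal{S}$ of isometries of $\mathcal{H}$ having a common fixed point, and $x\in\mathcal{H}$, let $\mathcal{S}(x)=\{Tx: T\in\mathcal{S}\}$. It is known that there is a unique point $CC_{\mathcal{S}}(x)$ that lies in the affine hull $\operatorname{aff}(\mathcal{S}(x))$ and is equidistant from all points of $\mathcal{S}(x)$; this defines the circumcenter mapping $CC_{\mathcal{S}}:\mathcal{H}\to\mathcal{H}$. $CC_{\mathcal{S}}^k$ is its $k$-fold composition. *)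

theory Defs
  imports "HOL-Analysis.Analysis"
begin

definition isometry :: "('a::real_normed_vector \<Rightarrow> 'a) \<Rightarrow> bool" where
  "isometry T \<longleftrightarrow> (\<forall>x y. norm (T x - T y) = norm (x - y))"

definition Fix :: "('a \<Rightarrow> 'a) \<Rightarrow> 'a set" where
  "Fix T = {x. T x = x}"

definition compositions :: "('a \<Rightarrow> 'a) set \<Rightarrow> ('a \<Rightarrow> 'a) set" where
  "compositions \<F> = {foldr (\<circ>) Ts id |Ts. set Ts \<subseteq> \<F>}"

definition orbit_set :: "('a \<Rightarrow> 'a) set \<Rightarrow> 'a \<Rightarrow> 'a set" where
  "orbit_set \<S> x = {T x |T. T \<in> \<S>}"

text \<open>The description below denotes a unique point whenever \<open>\<S>\<close> is a nonempty finite set of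
  isometries with a common fixed point; otherwise the value may be unspecified.\<close>

definition CC :: "('a::real_inner \<Rightarrow> 'a) set \<Rightarrow> 'a \<Rightarrow> 'a" where
  "CC \<S> x = (THE p. p \<in> affine hull (orbit_set \<S> x) \<and>
      (\<forall>y \<in> orbit_set \<S> x. \<forall>z \<in> orbit_set \<S> x. dist p y = dist p z))"

text \<open>The rate \<open>\<gamma> = 0\<close> is allowed; since \<open>0 ^ 0 = 1\<close> it then says that \<open>u k = l\<close> for all
  \<open>k \<ge> 1\<close>.\<close>

definition converges_with_linear_rate ::
    "(nat \<Rightarrow> 'a::real_normed_vector) \<Rightarrow> 'a \<Rightarrow> real \<Rightarrow> bool" where
  "converges_with_linear_rate u l \<gamma> \<longleftrightarrow>
     u \<longlonglongrightarrow> l \<and> 0 \<le> \<gamma> \<and> \<gamma> < 1 \<and> (\<exists>M. \<forall>k. norm (u k - l) \<le> M * \<gamma> ^ k)"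

end

theory Submission
  imports Defs
begin

text \<open>Let \<open>V\<close> be the common fixed point space and \<open>v \<in> V\<close>. Since every \<open>T \<in> \<S>\<close> is an isometry that
  fixes \<open>v\<close>, the orbit of \<open>x\<close> lies on a sphere around \<open>v\<close>. By Pythagoras the projection of \<open>v\<close>
  onto the affine hull of the orbit is then equidistant from the orbit; it is therefore the
  circumcenter (\<open>CC_eq_closest_point\<close>). So \<open>CC \<S> x\<close> is, for \<^emph>\<open>every\<close> \<open>v \<in> V\<close> at once, the point of
  that affine hull that is nearest to \<open>v\<close>. The point \<open>A x\<close> is a convex combination of the orbit points \<open>x\<close> and
  \<open>F i x\<close>, so it belongs to the affine hull too, and hence
  \<open>dist v (CC \<S> x) \<le> dist v (A x)\<close>: one step of the circumcenter iteration does at least as well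
  as one step of \<open>A\<close>.

  Linear isometries that fix \<open>V\<close> pointwise move points only in directions orthogonal to \<open>V\<close>, so
  \<open>CC \<S>\<close> does not change the projection of a point onto \<open>V\<close>. Taking \<open>v\<close> to be this projection in
  the inequality above, one step contracts the distance to \<open>v\<close> by the factor
  \<open>\<gamma> = onorm (A \<circ> closest_point (V\<^sup>\<bottom>))\<close>, and the projection stays the same for the next step,
  so the estimate iterates.

  Finally \<open>\<gamma> < 1\<close>: by strict convexity of the ball, \<open>A\<close> strictly shortens each vector that is moved
  by some \<open>F i\<close> (\<open>norm_average_less\<close>), in particular each nonzero vector of \<open>V\<^sup>\<bottom>\<close>, and in finite
  dimension a pointwise strict contraction has operator norm below 1
  (\<open>onorm_less_one_if_strict\<close>). The same strict inequality shows that \<open>A\<close> has no fixed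
  points outside \<open>V\<close>.\<close>


section \<open>Projections onto affine sets and subspaces\<close>

lemma closest_point_affine_orthogonal:
  fixes S :: "'a::euclidean_space set"
  assumes "affine S" "closed S" "y \<in> S"
  shows "(v - closest_point S v) \<bullet> (y - closest_point S v) = 0"
proof -
  let ?p = "closest_point S v"
  have p: "?p \<in> S"
    using assms closest_point_in_set by blast
  \<comment> \<open>The reflection of \<open>y\<close> in the projection also lies in \<open>S\<close>, so the obtuse angle inequality
    for convex sets holds with both signs.\<close>
  have "2 *\<^sub>R ?p + (-1) *\<^sub>R y \<in> S"
    using mem_affine[OF assms(1) p assms(3), of 2 "-1"] by simp
  then have "(v - ?p) \<bullet> ((2 *\<^sub>R ?p + (-1) *\<^sub>R y) - ?p) \<le> 0"
    using closest_point_dot assms affine_imp_convex by blast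
  moreover have "(2 *\<^sub>R ?p + (-1) *\<^sub>R y) - ?p = - (y - ?p)"
    by (simp add: scaleR_2)
  moreover have "(v - ?p) \<bullet> (y - ?p) \<le> 0"
    using closest_point_dot assms affine_imp_convex by blast
  ultimately show ?thesis
    by (metis inner_minus_right neg_le_0_iff_le order_antisym)
qed

lemma closest_point_subspace_in:
  fixes V :: "'a::euclidean_space set"
  assumes "subspace V"
  shows "closest_point V x \<in> V"
  using assms closed_subspace closest_point_in_set subspace_0 by blast

lemma diff_closest_point_in_orthogonal_comp:
  fixes V :: "'a::euclidean_space set"
  assumes "subspace V"
  shows "x - closest_point V x \<in> V\<^sup>\<bottom>"
proof -
  have "v \<bullet> (x - closest_point V x) = 0" if "v \<in> V" for v
  proof -
    have "v + closest_point V x \<in> V"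
      using assms that closest_point_subspace_in subspace_add by blast
    then show ?thesis
      using closest_point_affine_orthogonal[of V "v + closest_point V x" x] assms
        closed_subspace subspace_imp_affine by (auto simp: inner_commute)
  qed
  then show ?thesis
    by (simp add: orthogonal_comp_def orthogonal_def)
qed

lemma closest_point_subspace_eqI:
  fixes V :: "'a::euclidean_space set"
  assumes "subspace V" "y \<in> V" "x - y \<in> V\<^sup>\<bottom>"
  shows "closest_point V x = y"
proof -
  have "dist x y \<le> dist x z" if "z \<in> V" for z
  proof -
    have "(y - z) \<bullet> (x - y) = 0"
      using assms that subspace_diff by (auto simp: orthogonal_comp_def orthogonal_def)
    then have "(norm (x - z))\<^sup>2 = (norm (x - y))\<^sup>2 + (norm (y - z))\<^sup>2"
      using norm_add_Pythagorean[of "x - y" "y - z"]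
      by (simp add: orthogonal_def inner_commute)
    then show ?thesis
      by (simp add: dist_norm power2_le_imp_le)
  qed
  then show ?thesis
    using closest_point_unique[of V y x] assms closed_subspace subspace_imp_convex by fastforce
qed

lemma linear_closest_point_subspace:
  fixes V :: "'a::euclidean_space set"
  assumes "subspace V"
  shows "linear (closest_point V)"
proof (rule linearI)
  note sub = subspace_orthogonal_comp[of V]
  note d = diff_closest_point_in_orthogonal_comp[OF assms]
  fix x y :: 'a and c :: real
  have "(x - closest_point V x) + (y - closest_point V y) \<in> V\<^sup>\<bottom>"
    using sub d subspace_add by blast
  then have "(x + y) - (closest_point V x + closest_point V y) \<in> V\<^sup>\<bottom>"
    by (simp add: algebra_simps)
  then show "closest_point V (x + y) = closest_point V x + closest_point V y"
    by (intro closest_point_subspace_eqI)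
      (auto simp: assms closest_point_subspace_in subspace_add)
  have "c *\<^sub>R (x - closest_point V x) \<in> V\<^sup>\<bottom>"
    using sub d subspace_scale by blast
  then have "c *\<^sub>R x - c *\<^sub>R closest_point V x \<in> V\<^sup>\<bottom>"
    by (simp add: scaleR_diff_right)
  then show "closest_point V (c *\<^sub>R x) = c *\<^sub>R closest_point V x"
    by (intro closest_point_subspace_eqI)
      (auto simp: assms closest_point_subspace_in subspace_scale)
qed

lemma norm_closest_point_subspace_le:
  fixes V :: "'a::euclidean_space set"
  assumes "subspace V"
  shows "norm (closest_point V x) \<le> norm x"
proof -
  have "closest_point V x \<bullet> (x - closest_point V x) = 0"
    using diff_closest_point_in_orthogonal_comp[OF assms, of x]
      closest_point_subspace_in[OF assms, of x]
    by (simp add: orthogonal_comp_def orthogonal_def)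
  then have "(norm x)\<^sup>2 = (norm (closest_point V x))\<^sup>2 + (norm (x - closest_point V x))\<^sup>2"
    using norm_add_Pythagorean[of "closest_point V x" "x - closest_point V x"]
    by (simp add: orthogonal_def)
  then show ?thesis
    by (simp add: power2_le_imp_le)
qed


section \<open>The circumcenter as a projection\<close>

lemma equidistant_imp_orthogonal:
  fixes p q :: "'a::real_inner"
  assumes "dist p y = dist p z" "dist q y = dist q z"
  shows "(p - q) \<bullet> y = (p - q) \<bullet> z"
proof -
  have "(p - y) \<bullet> (p - y) = (p - z) \<bullet> (p - z)" "(q - y) \<bullet> (q - y) = (q - z) \<bullet> (q - z)"
    using assms by (simp_all add: dist_norm norm_eq)
  then show ?thesis
    by (simp add: inner_diff_left inner_diff_right inner_commute)
qed

text \<open>The difference of two circumcenters is orthogonal to all differences of points of \<open>K\<close>, hence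
  to the direction space of the affine hull, to which the difference itself belongs.\<close>

lemma equidistant_affine_hull_unique:
  fixes K :: "'a::real_inner set"
  assumes "p \<in> affine hull K" "q \<in> affine hull K"
    and p: "\<And>y z. y \<in> K \<Longrightarrow> z \<in> K \<Longrightarrow> dist p y = dist p z"
    and q: "\<And>y z. y \<in> K \<Longrightarrow> z \<in> K \<Longrightarrow> dist q y = dist q z"
  shows "p = q"
proof -
  have "K \<noteq> {}"
    using assms(1) by auto
  then obtain k where k: "k \<in> K"
    by blast
  have "K \<subseteq> {y. (p - q) \<bullet> y = (p - q) \<bullet> k}"
    using equidistant_imp_orthogonal p q k by blast
  then have "affine hull K \<subseteq> {y. (p - q) \<bullet> y = (p - q) \<bullet> k}"
    by (rule hull_minimal) (rule affine_hyperplane)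
  then have "(p - q) \<bullet> p = (p - q) \<bullet> k" "(p - q) \<bullet> q = (p - q) \<bullet> k"
    using assms(1,2) by blast+
  then have "(p - q) \<bullet> (p - q) = 0"
    by (simp add: inner_diff_right)
  then show ?thesis
    by simp
qed

lemma closest_point_affine_hull_equidistant:
  fixes K :: "'a::euclidean_space set"
  assumes "y \<in> K" "z \<in> K" "dist v y = dist v z"
  shows "dist (closest_point (affine hull K) v) y = dist (closest_point (affine hull K) v) z"
proof -
  let ?p = "closest_point (affine hull K) v"
  have pyth: "(dist v w)\<^sup>2 = (dist v ?p)\<^sup>2 + (dist ?p w)\<^sup>2" if "w \<in> K" for w
  proof -
    have "(v - ?p) \<bullet> (w - ?p) = 0"
      by (intro closest_point_affine_orthogonal) (auto simp: that hull_inc)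
    then have "orthogonal (v - ?p) (?p - w)"
      by (simp add: orthogonal_def inner_diff_right)
    then show ?thesis
      using norm_add_Pythagorean[of "v - ?p" "?p - w"] by (simp add: dist_norm)
  qed
  have "(dist ?p y)\<^sup>2 = (dist ?p z)\<^sup>2"
    using pyth[OF assms(1)] pyth[OF assms(2)] assms(3) by simp
  then show ?thesis
    by simp
qed

lemma CC_eqI:
  assumes "p \<in> affine hull (orbit_set \<S> x)"
    and "\<And>y z. y \<in> orbit_set \<S> x \<Longrightarrow> z \<in> orbit_set \<S> x \<Longrightarrow> dist p y = dist p z"
  shows "CC \<S> x = p"
  unfolding CC_def
proof (rule the_equality)
  show "p \<in> affine hull (orbit_set \<S> x) \<and>
      (\<forall>y \<in> orbit_set \<S> x. \<forall>z \<in> orbit_set \<S> x. dist p y = dist p z)"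
    using assms by blast
  show "q = p" if "q \<in> affine hull (orbit_set \<S> x) \<and>
      (\<forall>y \<in> orbit_set \<S> x. \<forall>z \<in> orbit_set \<S> x. dist q y = dist q z)" for q
    using that assms equidistant_affine_hull_unique[of q "orbit_set \<S> x" p] by blast
qed

lemma isometry_dist_fixed:
  assumes "isometry T" "v \<in> Fix T"
  shows "dist v (T x) = dist v x"
proof -
  have "norm (T v - T x) = norm (v - x)"
    using assms(1) by (simp add: isometry_def)
  then show ?thesis
    using assms(2) by (simp add: Fix_def dist_norm)
qed

text \<open>The left-hand side does not mention \<open>v\<close>, so all common fixed points have the same projection
  onto the affine hull of an orbit. This freedom to choose \<open>v\<close> is what makes the circumcenter
  comparable with other points of the affine hull.\<close>

lemma CC_eq_closest_point:
  fixes \<S> :: "('a::euclidean_space \<Rightarrow> 'a) set"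
  assumes "\<S> \<noteq> {}" "\<And>T. T \<in> \<S> \<Longrightarrow> isometry T" "v \<in> (\<Inter>T\<in>\<S>. Fix T)"
  shows "CC \<S> x = closest_point (affine hull (orbit_set \<S> x)) v"
proof (rule CC_eqI)
  let ?K = "orbit_set \<S> x"
  have "affine hull ?K \<noteq> {}"
    using assms(1) by (auto simp: orbit_set_def)
  then show "closest_point (affine hull ?K) v \<in> affine hull ?K"
    by (intro closest_point_in_set) auto
  have sphere: "dist v y = dist v x" if "y \<in> ?K" for y
  proof -
    from that obtain T where "T \<in> \<S>" "y = T x"
      by (auto simp: orbit_set_def)
    then show ?thesis
      using isometry_dist_fixed assms(2,3) by blast
  qed
  show "dist (closest_point (affine hull ?K) v) y = dist (closest_point (affine hull ?K) v) z"
    if "y \<in> ?K" "z \<in> ?K" for y z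
    using closest_point_affine_hull_equidistant that sphere by metis
qed

lemma CC_in_affine_hull:
  fixes \<S> :: "('a::euclidean_space \<Rightarrow> 'a) set"
  assumes "\<S> \<noteq> {}" "\<And>T. T \<in> \<S> \<Longrightarrow> isometry T" "v \<in> (\<Inter>T\<in>\<S>. Fix T)"
  shows "CC \<S> x \<in> affine hull (orbit_set \<S> x)"
proof -
  have "CC \<S> x = closest_point (affine hull (orbit_set \<S> x)) v"
    by (rule CC_eq_closest_point) (use assms in auto)
  moreover have "affine hull (orbit_set \<S> x) \<noteq> {}"
    using assms(1) by (auto simp: orbit_set_def)
  ultimately show ?thesis
    using closest_point_in_set closed_affine_hull by metis
qed

lemma Fix_CC:
  fixes \<S> :: "('a::euclidean_space \<Rightarrow> 'a) set"
  assumes "id \<in> \<S>" "\<And>T. T \<in> \<S> \<Longrightarrow> isometry T" "v \<in> (\<Inter>T\<in>\<S>. Fix T)"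
  shows "Fix (CC \<S>) = (\<Inter>T\<in>\<S>. Fix T)"
proof (intro subset_antisym subsetI)
  fix x assume "x \<in> Fix (CC \<S>)"
  then have CC: "CC \<S> x = x"
    by (simp add: Fix_def)
  have CC_proj: "CC \<S> x = closest_point (affine hull (orbit_set \<S> x)) v"
    by (rule CC_eq_closest_point) (use assms in auto)
  have "T x = x" if "T \<in> \<S>" for T
  proof -
    have "id x \<in> orbit_set \<S> x"
      using assms(1) unfolding orbit_set_def by blast
    moreover have "T x \<in> orbit_set \<S> x"
      using that unfolding orbit_set_def by blast
    ultimately have orbit: "x \<in> orbit_set \<S> x" "T x \<in> orbit_set \<S> x"
      by simp_all
    \<comment> \<open>The circumcenter \<open>x\<close> is itself a point of the orbit, so the circumradius is zero.\<close>
    have "dist (CC \<S> x) (T x) = dist (CC \<S> x) x"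
      unfolding CC_proj
    proof (rule closest_point_affine_hull_equidistant)
      show "dist v (T x) = dist v x"
        using isometry_dist_fixed assms(2,3) that by blast
    qed (use orbit in auto)
    then show ?thesis
      by (simp add: CC)
  qed
  then show "x \<in> (\<Inter>T\<in>\<S>. Fix T)"
    by (simp add: Fix_def)
next
  fix x assume x: "x \<in> (\<Inter>T\<in>\<S>. Fix T)"
  then have "T x = x" if "T \<in> \<S>" for T
    using that by (simp add: Fix_def)
  moreover have "id x \<in> orbit_set \<S> x"
    unfolding orbit_set_def using assms(1) by blast
  ultimately have "orbit_set \<S> x = {x}"
    by (auto simp: orbit_set_def)
  then have "CC \<S> x = x"
    by (intro CC_eqI) auto
  then show "x \<in> Fix (CC \<S>)"
    by (simp add: Fix_def)
qed


section \<open>Linear isometries and their fixed points\<close>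

lemma isometry_orthogonal_transformation:
  assumes "orthogonal_transformation T"
  shows "isometry T"
  using assms by (simp add: isometry_def orthogonal_transformation flip: linear_diff)

lemma orthogonal_transformation_if_linear_isometry:
  assumes "linear T" "isometry T"
  shows "orthogonal_transformation T"
  unfolding orthogonal_transformation
proof (intro conjI allI)
  show "norm (T x) = norm x" for x
    using assms(2)[unfolded isometry_def, rule_format, of x 0] assms(1) by (simp add: linear_0)
qed (rule assms(1))

lemma foldr_comp_orthogonal_transformation:
  assumes "\<And>T. T \<in> set Ts \<Longrightarrow> orthogonal_transformation T"
  shows "orthogonal_transformation (foldr (\<circ>) Ts id)"
  using assms
proof (induction Ts)
  case Nil
  then show ?case
    using orthogonal_transformation_id by (simp add: id_def)
next
  case (Cons T Ts)
  have "orthogonal_transformation T"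
    by (rule Cons.prems) simp
  moreover have "orthogonal_transformation (foldr (\<circ>) Ts id)"
    by (rule Cons.IH) (simp add: Cons.prems)
  ultimately have "orthogonal_transformation (T \<circ> foldr (\<circ>) Ts id)"
    by (rule orthogonal_transformation_compose)
  then show ?case
    by (subst foldr.simps(2), subst comp_apply)
qed

lemma foldr_comp_fixes:
  assumes "\<And>T. T \<in> set Ts \<Longrightarrow> T x = x"
  shows "foldr (\<circ>) Ts id x = x"
  using assms by (induction Ts) auto

lemma subspace_Fix:
  assumes "linear T"
  shows "subspace (Fix T)"
  using assms by (auto simp: subspace_def Fix_def linear_0 linear_add linear_scale)

lemma inner_orbit_fixed:
  assumes "orthogonal_transformation T" "v \<in> Fix T"
  shows "v \<bullet> T x = v \<bullet> x"
proof -
  have "T v \<bullet> T x = v \<bullet> x"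
    using assms(1) by (simp add: orthogonal_transformation_def)
  then show ?thesis
    using assms(2) by (simp add: Fix_def)
qed

text \<open>Each orbit lies in a translate of the orthogonal complement of the common fixed points; so does
  its affine hull, which contains the circumcenter.\<close>

lemma affine_hull_orbit_diff_orthogonal:
  fixes \<S> :: "('a::euclidean_space \<Rightarrow> 'a) set"
  assumes "\<And>T. T \<in> \<S> \<Longrightarrow> orthogonal_transformation T" "y \<in> affine hull (orbit_set \<S> x)"
  shows "y - x \<in> (\<Inter>T\<in>\<S>. Fix T)\<^sup>\<bottom>"
proof -
  have "v \<bullet> (y - x) = 0" if "v \<in> (\<Inter>T\<in>\<S>. Fix T)" for v
  proof -
    have "orbit_set \<S> x \<subseteq> {y. v \<bullet> y = v \<bullet> x}"
      using that assms(1) inner_orbit_fixed by (fastforce simp: orbit_set_def)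
    then have "affine hull (orbit_set \<S> x) \<subseteq> {y. v \<bullet> y = v \<bullet> x}"
      by (rule hull_minimal) (rule affine_hyperplane)
    then show ?thesis
      using assms(2) by (auto simp: inner_diff_right)
  qed
  then show ?thesis
    by (simp add: orthogonal_comp_def orthogonal_def)
qed


section \<open>Strict contraction\<close>

text \<open>Because \<open>T\<close> preserves the norm, writing out the square gives
  \<open>\<parallel>(1 - a) u + a T u\<parallel>\<^sup>2 = \<parallel>u\<parallel>\<^sup>2 - a (1 - a) \<parallel>u - T u\<parallel>\<^sup>2\<close>.\<close>

lemma norm_relaxation_less:
  fixes u :: "'a::euclidean_space"
  assumes "orthogonal_transformation T" "0 < a" "a < 1" "T u \<noteq> u"
  shows "norm ((1 - a) *\<^sub>R u + a *\<^sub>R T u) < norm u"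
proof -
  let ?w = "u - T u"
  have "T u \<bullet> T u = u \<bullet> u"
    using assms(1) by (simp add: orthogonal_transformation_def)
  then have w: "?w \<bullet> ?w = 2 * (u \<bullet> ?w)"
    by (simp add: inner_diff_left inner_diff_right inner_commute)
  have "(1 - a) *\<^sub>R u + a *\<^sub>R T u = u - a *\<^sub>R ?w"
    by (simp add: algebra_simps)
  then have "((1 - a) *\<^sub>R u + a *\<^sub>R T u) \<bullet> ((1 - a) *\<^sub>R u + a *\<^sub>R T u)
      = (u - a *\<^sub>R ?w) \<bullet> (u - a *\<^sub>R ?w)"
    by simp
  also have "\<dots> = u \<bullet> u - a * (2 * (u \<bullet> ?w)) + a * a * (?w \<bullet> ?w)"
    unfolding inner_diff_left[of u "a *\<^sub>R ?w"] inner_diff_right[of _ u "a *\<^sub>R ?w"]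
    by (simp only: inner_scaleR_left inner_scaleR_right inner_commute[of ?w u] mult.assoc)
  also have "\<dots> = u \<bullet> u - a * (1 - a) * (?w \<bullet> ?w)"
    unfolding w by (simp add: left_diff_distrib right_diff_distrib)
  finally have "((1 - a) *\<^sub>R u + a *\<^sub>R T u) \<bullet> ((1 - a) *\<^sub>R u + a *\<^sub>R T u)
      = u \<bullet> u - a * (1 - a) * (?w \<bullet> ?w)" .
  moreover have "0 < a * (1 - a) * (?w \<bullet> ?w)"
    using assms by simp
  ultimately show ?thesis
    by (simp add: norm_lt)
qed

lemma norm_average_less:
  fixes u :: "'a::euclidean_space"
  assumes "finite I" and orth: "\<And>i. i \<in> I \<Longrightarrow> orthogonal_transformation (F i)"
    and w: "\<And>i. i \<in> I \<Longrightarrow> 0 < w i" and "sum w I = 1"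
    and a: "\<And>i. i \<in> I \<Longrightarrow> 0 < a i \<and> a i < 1"
    and "j \<in> I" "F j u \<noteq> u"
  shows "norm (\<Sum>i\<in>I. w i *\<^sub>R ((1 - a i) *\<^sub>R u + a i *\<^sub>R F i u)) < norm u"
proof -
  let ?G = "\<lambda>i. (1 - a i) *\<^sub>R u + a i *\<^sub>R F i u"
  have less: "norm (?G i) < norm u" if "i \<in> I" "F i u \<noteq> u" for i
    using norm_relaxation_less orth a that by blast
  have le: "norm (?G i) \<le> norm u" if "i \<in> I" for i
  proof (cases "F i u = u")
    case True
    then have "?G i = u"
      by (simp add: scaleR_diff_left)
    then show ?thesis
      by simp
  qed (use less[OF that] in simp)
  have "norm (\<Sum>i\<in>I. w i *\<^sub>R ?G i) \<le> (\<Sum>i\<in>I. norm (w i *\<^sub>R ?G i))"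
    by (rule norm_sum)
  also have "\<dots> = (\<Sum>i\<in>I. w i * norm (?G i))"
  proof (intro sum.cong refl)
    show "norm (w i *\<^sub>R ?G i) = w i * norm (?G i)" if "i \<in> I" for i
      using w[OF that] by simp
  qed
  also have "\<dots> < (\<Sum>i\<in>I. w i * norm u)"
  proof (rule sum_strict_mono_ex1)
    show "\<forall>i\<in>I. w i * norm (?G i) \<le> w i * norm u"
      using w le by (meson less_imp_le mult_left_mono)
    show "\<exists>i\<in>I. w i * norm (?G i) < w i * norm u"
      using w less assms(6,7) by (meson mult_strict_left_mono)
  qed (rule assms(1))
  also have "\<dots> = norm u"
    using assms(4) sum_distrib_right[of w I "norm u"] by simp
  finally show ?thesis .
qed

text \<open>The supremum in the operator norm is attained because the unit sphere is compact.\<close>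

lemma onorm_less_one_if_strict:
  fixes f :: "'a::euclidean_space \<Rightarrow> 'b::real_normed_vector"
  assumes "linear f" "\<And>x. x \<noteq> 0 \<Longrightarrow> norm (f x) < norm x"
  shows "onorm f < 1"
proof -
  have "bounded_linear f"
    using assms(1) by (rule linear_conv_bounded_linear[THEN iffD1])
  then have cont: "continuous_on (sphere 0 1) (\<lambda>x. norm (f x))"
    by (intro continuous_on_norm linear_continuous_on)
  obtain b :: 'a where "b \<in> Basis"
    using nonempty_Basis by blast
  then have "b \<in> sphere 0 1"
    by simp
  then have "sphere (0::'a) 1 \<noteq> {}"
    by blast
  then obtain m where m: "m \<in> sphere 0 1" "\<And>x. x \<in> sphere 0 1 \<Longrightarrow> norm (f x) \<le> norm (f m)"
    using continuous_attains_sup[OF compact_sphere _ cont] by metis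
  have "norm (f x) \<le> norm (f m) * norm x" for x
  proof (cases "x = 0")
    case True
    then show ?thesis
      using assms(1) by (simp add: linear_0)
  next
    case False
    have "norm (f ((1 / norm x) *\<^sub>R x)) \<le> norm (f m)"
      using False by (intro m(2)) simp
    also have "f ((1 / norm x) *\<^sub>R x) = (1 / norm x) *\<^sub>R f x"
      using assms(1) by (rule linear_scale)
    finally have "norm (f x) / norm x \<le> norm (f m)"
      by simp
    then show ?thesis
      using False by (simp add: pos_divide_le_eq)
  qed
  then have "onorm f \<le> norm (f m)"
    by (rule onorm_le)
  also have "norm (f m) < norm m"
    using m(1) by (intro assms(2)) auto
  also have "norm m = 1"
    using m(1) by simp
  finally show ?thesis .
qed


section \<open>Linear convergence of the circumcenter iteration\<close>

theorem theorem5p4: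
  fixes t :: nat
    and F :: "nat \<Rightarrow> real ^ 'n \<Rightarrow> real ^ 'n"
    and \<S> :: "(real ^ 'n \<Rightarrow> real ^ 'n) set"
    and \<omega> \<alpha> :: "nat \<Rightarrow> real"
    and Ai :: "nat \<Rightarrow> real ^ 'n \<Rightarrow> real ^ 'n"
    and A :: "real ^ 'n \<Rightarrow> real ^ 'n"
  assumes "t \<noteq> 0"
    and "\<And>i. i \<in> {1..t} \<Longrightarrow> linear (F i) \<and> isometry (F i)"
    and "finite \<S>"
    and "\<S> \<subseteq> compositions (F ` {1..t})"
    and "{id} \<union> F ` {1..t} \<subseteq> \<S>"
    and "\<And>i. i \<in> {1..t} \<Longrightarrow> 0 < \<omega> i \<and> \<omega> i \<le> 1"
    and "(\<Sum>i = 1..t. \<omega> i) = 1"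
    and "\<And>i. i \<in> {1..t} \<Longrightarrow> 0 < \<alpha> i \<and> \<alpha> i < 1"
    and "\<And>i. i \<in> {1..t} \<Longrightarrow> Ai i = (\<lambda>x. (1 - \<alpha> i) *\<^sub>R x + \<alpha> i *\<^sub>R F i x)"
    and "A = (\<lambda>x. \<Sum>i = 1..t. \<omega> i *\<^sub>R Ai i x)"
  shows "(Fix (CC \<S>) = (\<Inter>T\<in>\<S>. Fix T) \<and>
          (\<Inter>T\<in>\<S>. Fix T) = (\<Inter>i\<in>{1..t}. Fix (F i)) \<and>
          (\<Inter>i\<in>{1..t}. Fix (F i)) = Fix A) \<and>
         (let V = (\<Inter>i\<in>{1..t}. Fix (F i));
              \<gamma> = onorm (A \<circ> closest_point (V\<^sup>\<bottom>))
          in \<gamma> < 1 \<and>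
             (\<forall>x k. norm ((CC \<S> ^^ k) x - closest_point V x)
                      \<le> \<gamma> ^ k * norm (x - closest_point V x)) \<and>
             (\<forall>x. converges_with_linear_rate (\<lambda>k. (CC \<S> ^^ k) x) (closest_point V x) \<gamma>))"
proof -
  define V where "V = (\<Inter>i\<in>{1..t}. Fix (F i))"
  define \<gamma> where "\<gamma> = onorm (A \<circ> closest_point (V\<^sup>\<bottom>))"
  have orth: "orthogonal_transformation (F i)" if "i \<in> {1..t}" for i
    using assms(2)[OF that] orthogonal_transformation_if_linear_isometry by blast
  have FS: "F i \<in> \<S>" if "i \<in> {1..t}" for i
    using assms(5) that by auto
  have idS: "id \<in> \<S>"
    using assms(5) by auto
  then have ne: "\<S> \<noteq> {}"
    by auto
  have comp: "\<exists>Ts. T = foldr (\<circ>) Ts id \<and> set Ts \<subseteq> F ` {1..t}" if "T \<in> \<S>" for T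
    using assms(4) that by (auto simp: compositions_def)
  have orthS: "orthogonal_transformation T" if "T \<in> \<S>" for T
  proof -
    from comp[OF that] obtain Ts where Ts: "T = foldr (\<circ>) Ts id" "set Ts \<subseteq> F ` {1..t}"
      by blast
    show ?thesis
      unfolding Ts(1) by (rule foldr_comp_orthogonal_transformation) (use Ts(2) orth in auto)
  qed
  have isoS: "isometry T" if "T \<in> \<S>" for T
    using isometry_orthogonal_transformation orthS that by blast
  have VS: "(\<Inter>T\<in>\<S>. Fix T) = V"
  proof (intro subset_antisym subsetI)
    fix x assume "x \<in> (\<Inter>T\<in>\<S>. Fix T)"
    then show "x \<in> V"
      using FS by (auto simp: V_def)
  next
    fix x assume x: "x \<in> V"
    have "T x = x" if "T \<in> \<S>" for T
    proof -
      from comp[OF that] obtain Ts where Ts: "T = foldr (\<circ>) Ts id" "set Ts \<subseteq> F ` {1..t}"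
        by blast
      show ?thesis
        unfolding Ts(1) by (rule foldr_comp_fixes) (use Ts(2) x in \<open>auto simp: V_def Fix_def\<close>)
    qed
    then show "x \<in> (\<Inter>T\<in>\<S>. Fix T)"
      by (simp add: Fix_def)
  qed
  have subV: "subspace V"
    unfolding V_def
  proof (rule subspace_Inter, rule ballI, erule imageE)
    fix W i assume "W = Fix (F i)" "i \<in> {1..t}"
    then show "subspace W"
      using assms(2)[of i] by (simp add: subspace_Fix)
  qed
  have fixS: "v \<in> (\<Inter>T\<in>\<S>. Fix T)" if "v \<in> V" for v
    using VS that by simp
  have A_eq: "A x = (\<Sum>i = 1..t. \<omega> i *\<^sub>R ((1 - \<alpha> i) *\<^sub>R x + \<alpha> i *\<^sub>R F i x))" for x
    using assms(9,10) by simp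
  have A_fixed: "A v = v" if "v \<in> V" for v
  proof -
    have "A v = (\<Sum>i = 1..t. \<omega> i *\<^sub>R v)"
      unfolding A_eq using that
      by (intro sum.cong) (auto simp: V_def Fix_def scaleR_diff_left)
    also have "\<dots> = v"
      using assms(7) scaleR_sum_left[of \<omega> "{1..t}" v] by simp
    finally show ?thesis .
  qed
  have A_less: "norm (A u) < norm u" if "u \<notin> V" for u
  proof -
    obtain j where "j \<in> {1..t}" "F j u \<noteq> u"
      using \<open>u \<notin> V\<close> by (auto simp: V_def Fix_def)
    then show ?thesis
      unfolding A_eq using norm_average_less[of "{1..t}" F \<omega> \<alpha> j u] orth assms(6-8) by blast
  qed
  have FixA: "V = Fix A"
    using A_fixed A_less by (force simp: Fix_def)
  have linA: "linear A"
  proof (rule linearI)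
    fix x y :: "real ^ 'n" and c :: real
    have F: "F i (x + y) = F i x + F i y" "F i (c *\<^sub>R x) = c *\<^sub>R F i x" if "i \<in> {1..t}" for i
      using assms(2)[OF that] by (simp_all add: linear_add linear_scale)
    show "A (x + y) = A x + A y"
      unfolding A_eq sum.distrib[symmetric]
      by (intro sum.cong) (simp_all add: F algebra_simps)
    show "A (c *\<^sub>R x) = c *\<^sub>R A x"
      unfolding A_eq scaleR_sum_right
      by (intro sum.cong) (simp_all add: F algebra_simps)
  qed
  have A_hull: "A x \<in> affine hull (orbit_set \<S> x)" for x
  proof -
    let ?H = "affine hull (orbit_set \<S> x)"
    have "id x \<in> orbit_set \<S> x"
      using idS unfolding orbit_set_def by blast
    then have x: "x \<in> ?H"
      by (simp add: hull_inc)
    show ?thesis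
      unfolding A_eq
    proof (rule convex_sum)
      fix i assume i: "i \<in> {1..t}"
      have "F i x \<in> ?H"
        using FS[OF i] by (intro hull_inc) (auto simp: orbit_set_def)
      then show "(1 - \<alpha> i) *\<^sub>R x + \<alpha> i *\<^sub>R F i x \<in> ?H"
        using x by (intro mem_affine) auto
      show "0 \<le> \<omega> i"
        using assms(6)[OF i] by simp
    qed (use assms(7) in \<open>auto intro: affine_imp_convex\<close>)
  qed
  have CC_proj: "CC \<S> x = closest_point (affine hull (orbit_set \<S> x)) v" if "v \<in> V" for x v
    by (rule CC_eq_closest_point) (use ne isoS fixS that in auto)
  have CC_le: "norm (CC \<S> x - v) \<le> norm (A x - v)" if "v \<in> V" for x v
  proof -
    have "dist v (closest_point (affine hull (orbit_set \<S> x)) v) \<le> dist v (A x)"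
      by (intro closest_point_le) (auto simp: A_hull)
    then show ?thesis
      using CC_proj[OF that] by (simp add: dist_norm norm_minus_commute)
  qed
  have proj_CC: "closest_point V (CC \<S> x) = closest_point V x" for x
  proof (rule closest_point_subspace_eqI[OF subV closest_point_subspace_in[OF subV]])
    have "CC \<S> x \<in> affine hull (orbit_set \<S> x)"
      by (rule CC_in_affine_hull) (use ne isoS fixS subspace_0[OF subV] in auto)
    then have "CC \<S> x - x \<in> V\<^sup>\<bottom>"
      unfolding VS[symmetric] by (intro affine_hull_orbit_diff_orthogonal) (use orthS in auto)
    then have "(CC \<S> x - x) + (x - closest_point V x) \<in> V\<^sup>\<bottom>"
      using diff_closest_point_in_orthogonal_comp[OF subV] subspace_orthogonal_comp subspace_add
      by blast
    then show "CC \<S> x - closest_point V x \<in> V\<^sup>\<bottom>"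
      by simp
  qed
  have lin: "linear (A \<circ> closest_point (V\<^sup>\<bottom>))"
    using linear_compose linA linear_closest_point_subspace subspace_orthogonal_comp by blast
  then have blin: "bounded_linear (A \<circ> closest_point (V\<^sup>\<bottom>))"
    by (rule linear_conv_bounded_linear[THEN iffD1])
  have \<gamma>1: "\<gamma> < 1"
    unfolding \<gamma>_def
  proof (rule onorm_less_one_if_strict[OF lin])
    fix x :: "real ^ 'n" assume "x \<noteq> 0"
    let ?u = "closest_point (V\<^sup>\<bottom>) x"
    have u: "?u \<in> V\<^sup>\<bottom>"
      using closest_point_subspace_in subspace_orthogonal_comp by blast
    \<comment> \<open>Where the strictness comes from depends on \<open>?u\<close>: if \<open>?u = 0\<close>, from \<open>x \<noteq> 0\<close>; otherwise
      \<open>?u\<close> is not in \<open>V\<close>, and \<open>A\<close> shortens it.\<close>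
    show "norm ((A \<circ> closest_point (V\<^sup>\<bottom>)) x) < norm x"
    proof (cases "?u \<in> V")
      case True
      then have "?u = 0"
        using u by (auto simp: orthogonal_comp_def orthogonal_def)
      then show ?thesis
        using \<open>x \<noteq> 0\<close> linA by (simp add: linear_0)
    next
      case False
      then have "norm (A ?u) < norm ?u"
        by (rule A_less)
      also have "\<dots> \<le> norm x"
        using norm_closest_point_subspace_le subspace_orthogonal_comp by blast
      finally show ?thesis
        by simp
    qed
  qed
  have \<gamma>0: "0 \<le> \<gamma>"
    unfolding \<gamma>_def using blin by (rule onorm_pos_le)
  have step: "norm (CC \<S> x - closest_point V x) \<le> \<gamma> * norm (x - closest_point V x)" for x
  proof -
    let ?v = "closest_point V x"
    have v: "?v \<in> V"
      using subV by (rule closest_point_subspace_in)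
    have "norm (CC \<S> x - ?v) \<le> norm (A x - ?v)"
      using v by (rule CC_le)
    also have "A x - ?v = A (x - ?v)"
      using A_fixed[OF v] linA by (simp add: linear_diff)
    \<comment> \<open>The residual \<open>x - ?v\<close> lies in \<open>V\<^sup>\<bottom>\<close>, so projecting it there changes nothing.\<close>
    also have "\<dots> = (A \<circ> closest_point (V\<^sup>\<bottom>)) (x - ?v)"
      using closest_point_self[OF diff_closest_point_in_orthogonal_comp[OF subV]] by simp
    also have "norm \<dots> \<le> \<gamma> * norm (x - ?v)"
      unfolding \<gamma>_def using blin by (rule onorm)
    finally show ?thesis .
  qed
  have proj_iter: "closest_point V ((CC \<S> ^^ k) x) = closest_point V x" for x k
    by (induction k) (simp_all add: proj_CC)
  have bound: "norm ((CC \<S> ^^ k) x - closest_point V x) \<le> \<gamma> ^ k * norm (x - closest_point V x)"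
    for x k
  proof (induction k)
    case 0
    show ?case
      by simp
  next
    case (Suc k)
    have "norm ((CC \<S> ^^ Suc k) x - closest_point V x)
        \<le> \<gamma> * norm ((CC \<S> ^^ k) x - closest_point V x)"
      using step[of "(CC \<S> ^^ k) x"] by (simp add: proj_iter)
    also have "\<dots> \<le> \<gamma> * (\<gamma> ^ k * norm (x - closest_point V x))"
      using Suc \<gamma>0 by (rule mult_left_mono)
    finally show ?case
      by (simp add: mult.assoc)
  qed
  have conv: "converges_with_linear_rate (\<lambda>k. (CC \<S> ^^ k) x) (closest_point V x) \<gamma>" for x
    unfolding converges_with_linear_rate_def
  proof (intro conjI)
    have "(\<lambda>k. \<gamma> ^ k * norm (x - closest_point V x)) \<longlonglongrightarrow> 0"
      using \<gamma>0 \<gamma>1 by (intro tendsto_mult_left_zero LIMSEQ_power_zero) simp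
    then have "(\<lambda>k. (CC \<S> ^^ k) x - closest_point V x) \<longlonglongrightarrow> 0"
      by (rule Lim_null_comparison[rotated]) (simp add: bound)
    then show "(\<lambda>k. (CC \<S> ^^ k) x) \<longlonglongrightarrow> closest_point V x"
      by (rule LIM_zero_cancel)
    show "\<exists>M. \<forall>k. norm ((CC \<S> ^^ k) x - closest_point V x) \<le> M * \<gamma> ^ k"
      using bound[of _ x] by (intro exI[of _ "norm (x - closest_point V x)"]) (simp add: mult.commute)
  qed (rule \<gamma>0 \<gamma>1)+
  have "Fix (CC \<S>) = (\<Inter>T\<in>\<S>. Fix T)"
    by (rule Fix_CC) (use idS isoS fixS subspace_0[OF subV] in auto)
  then show ?thesis
    using VS FixA \<gamma>1 bound conv unfolding Let_def V_def[symmetric] \<gamma>_def[symmetric]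
    by (intro conjI allI) simp_all
qed

end
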